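(* Let $\langle G,m\rangle$, $G=(V,E)$, $m:E\to\mathbb Z^d$, be a $d$-periodic orbit graph that is generically minimally rigid on the fixed torus $\mathcal T_0^d$. Then for all subsets of edges $Y\subseteq E$, $$|Y|\;\le\; d\,|V(Y)|-\binom{d+1}{2}+\sum_{i=1}^{|\mathcal M_{\mathcal C}(Y)|}(d-i),$$ where $V(Y)$ is the set of vertices incident to edges of $Y$ and $|\mathcal M_{\mathcal C}(Y)|$ is the dimension of the gain space of $Y$.
   Context: A $d$-periodic orbit graph (gain graph) $\langle G,m\rangle$ consists of a finite connected multigraph $G=(V,E)$ (loops and multiple edges allowed), each of whose edges is given an orientation, and a map $m:E\to\mathbb Z^d$. An edge directed from $v_i$ to $v_j$ with gain $m_e$ is written $\{v_i,v_j;m_e\}$ and is identified with $\{v_j,v_i;-m_e\}$. The torus is taken to be the unit torus: $\mathcal T_0^d=\mathbb R^d/\mathbb Z^d$, represented by $[0,1)^d$. A framework on $\mathcal T_0^d$ is a pair $(\langle G,m\rangle,p)$ with $p:V\to[0,1)^d$ injective; write $p_i=p(v_i)$. An infinitesimal motion of $(\langle G,m\rangle,p)$ on $\mathcal T_0^d$ is a map $u:V\to\mathbb R^d$ with $(u_i-u_j)\cdot(p_i-p_j-m_e)=0$ for every edge $e=\{v_i,v_j;m_e\}$. The framework is infinitesimally rigid if all its infinitesimal motions are infinitesimal translations ($u_1=\dots=u_{|V|}$). The rigidity matrix $\mathbf R_0(\langle G,m\rangle,p)$ is the $|E|\times d|V|$ matrix of this linear system: the row of $\{v_i,v_j;m_e\}$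 has $p_i-p_j-m_e$ in the $d$ columns of $v_i$, its negative in the columns of $v_j$, and $0$ elsewhere (a loop gives a zero row). Generic: for $k\in\mathbb Z_+$ let $K_k$ be the set of all edges between pairs of vertices of $V$ with gains in $\{-k,\dots,k\}^d$. For each $E'\subset K_k$ whose rows in the rigidity matrix are linearly independent for some $p\in\mathbb R^{d|V|}$, consider the $|E'|\times|E'|$ minors of these rows as polynomials in the coordinates of $p$; each minor not identically zero defines a variety (its zero set). $\mathcal X_k\subset\mathbb R^{d|V|}$ is the (finite) union of all these varieties. $p$ is generic if $p\notin\mathcal X_k$ for all $k$. $\langle G,m\rangle$ is generically minimally rigid on $\mathcal T_0^d$ if $|E|=d|V|-d$ and $(\langle G,m\rangle,p)$ is infinitesimally rigid for all generic $p:V\to[0,1)^d$. The net gain on a cycle of $G$ is the sum of the gains of its edges, each taken with sign $+1$ or $-1$ according to whether the cycle traverses the edge along or against its orientation. For a set of edges $Y$, the gain space $\mathcal M_{\mathcal C}(Y)$ is the span over $\mathbb Z$ (in $\mathbb Z^d$) of the net gains on all cycles contained in the subgraph formed by $Y$; $|\mathcal M_{\mathcal C}(Y)|$ denotes its dimension (rank).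
   Formalization: The bound is proved for edge sets Y with d ≤ |V(Y)| + |M_C(Y)|; without this condition it is false, e.g. for Y empty, or for a single edge when d = 3 (two vertices, three parallel edges with gains 0, e1, e2). *)

theory Defs
  imports
    "HOL-Analysis.Analysis"
    "Graph_Theory.Digraph_Component"
    "Jordan_Normal_Form.Determinant"
begin

no_notation Matrix.vec_index (infixl "$" 100)

section \<open>Periodic orbit graphs\<close>

text \<open>
  The oriented multigraph is a \<open>pre_digraph\<close> of the AFP entry Graph_Theory, where arcs have an
  identity of their own, so that loops and parallel edges are allowed, even parallel edges with
  equal gains. The dimension \<open>d\<close> is \<open>CARD('d)\<close>. The constant \<open>Digraph_Component.connected\<close> refers
  to the underlying undirected graph and includes that there is a vertex.
\<close>

definition orbit_graph :: "('v, 'e) pre_digraph \<Rightarrow> ('e \<Rightarrow> int ^ 'd) \<Rightarrow> bool" where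
  "orbit_graph G m \<longleftrightarrow> fin_digraph G \<and> Digraph_Component.connected G"

definition real_gain :: "int ^ 'd \<Rightarrow> real ^ 'd" where
  "real_gain z = (\<chi> c. real_of_int (z $ c))"


section \<open>Frameworks and infinitesimal rigidity on the unit torus\<close>

text \<open>
  Configurations and motions are total functions of which only the values on \<open>verts G\<close> matter.
\<close>

definition torus_framework :: "('v, 'e) pre_digraph \<Rightarrow> ('v \<Rightarrow> real ^ 'd) \<Rightarrow> bool" where
  "torus_framework G p \<longleftrightarrow>
     inj_on p (verts G) \<and> (\<forall>v\<in>verts G. \<forall>c. 0 \<le> p v $ c \<and> p v $ c < 1)"

definition infinitesimal_motion ::
  "('v, 'e) pre_digraph \<Rightarrow> ('e \<Rightarrow> int ^ 'd) \<Rightarrow> ('v \<Rightarrow> real ^ 'd) \<Rightarrow> ('v \<Rightarrow> real ^ 'd) \<Rightarrow> bool" where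
  "infinitesimal_motion G m p u \<longleftrightarrow>
     (\<forall>e\<in>arcs G. inner (u (tail G e) - u (head G e))
                       (p (tail G e) - p (head G e) - real_gain (m e)) = 0)"

definition infinitesimally_rigid ::
  "('v, 'e) pre_digraph \<Rightarrow> ('e \<Rightarrow> int ^ 'd) \<Rightarrow> ('v \<Rightarrow> real ^ 'd) \<Rightarrow> bool" where
  "infinitesimally_rigid G m p \<longleftrightarrow>
     (\<forall>u. infinitesimal_motion G m p u \<longrightarrow> (\<forall>v\<in>verts G. \<forall>w\<in>verts G. u v = u w))"


section \<open>Genericity\<close>

text \<open>
  An edge \<open>{v, w; z}\<close> is the triple \<open>(v, w, z)\<close>. The columns of the rigidity matrix are indexed by
  pairs of a vertex and a coordinate. The difference in the definition makes the row of a loop zero.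
  The triples \<open>(v, w, z)\<close> and \<open>(w, v, - z)\<close> have the same row. A set of triples that contains both
  is therefore dependent, so that identifying them would not change the varieties below.
\<close>

definition rigidity_entry ::
  "('v \<Rightarrow> real ^ 'd) \<Rightarrow> 'v \<times> 'v \<times> (int ^ 'd) \<Rightarrow> 'v \<times> 'd \<Rightarrow> real" where
  "rigidity_entry p = (\<lambda>(v, w, z) (x, c).
     (if x = v then (p v - p w - real_gain z) $ c else 0)
     - (if x = w then (p v - p w - real_gain z) $ c else 0))"

definition gain_edges :: "'v set \<Rightarrow> nat \<Rightarrow> ('v \<times> 'v \<times> (int ^ 'd)) set" where
  "gain_edges V k = {(v, w, z). v \<in> V \<and> w \<in> V \<and> (\<forall>c. \<bar>z $ c\<bar> \<le> int k)}"

text \<open>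
  Independence is that of the family of rows indexed by the edges, not of the set of rows.
\<close>

definition rows_independent ::
  "'v set \<Rightarrow> ('v \<Rightarrow> real ^ 'd) \<Rightarrow> ('v \<times> 'v \<times> (int ^ 'd)) set \<Rightarrow> bool" where
  "rows_independent V p F \<longleftrightarrow>
     (\<forall>a. (\<forall>x\<in>V. \<forall>c. (\<Sum>e\<in>F. a e * rigidity_entry p e (x, c)) = 0) \<longrightarrow> (\<forall>e\<in>F. a e = 0))"

text \<open>
  A minor is given by an enumeration of its rows and one of its columns. Other enumerations
  of the same rows and columns only change its sign, hence not its zero set.
\<close>

definition rigidity_minor ::
  "('v \<times> 'v \<times> (int ^ 'd)) list \<Rightarrow> ('v \<times> 'd) list \<Rightarrow> ('v \<Rightarrow> real ^ 'd) \<Rightarrow> real" where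
  "rigidity_minor es cs p =
     Determinant.det (Matrix.mat (length es) (length es)
       (\<lambda>(i, j). rigidity_entry p (es ! i) (cs ! j)))"

definition degenerate_set :: "'v set \<Rightarrow> nat \<Rightarrow> ('v \<Rightarrow> real ^ 'd) set" where
  "degenerate_set V k =
     \<Union> {{p. rigidity_minor es cs p = 0} | es cs.
          distinct es \<and> set es \<subseteq> gain_edges V k \<and> (\<exists>q. rows_independent V q (set es)) \<and>
          distinct cs \<and> set cs \<subseteq> V \<times> UNIV \<and> length cs = length es \<and>
          (\<exists>q. rigidity_minor es cs q \<noteq> 0)}"

definition generic :: "'v set \<Rightarrow> ('v \<Rightarrow> real ^ 'd) \<Rightarrow> bool" where
  "generic V p \<longleftrightarrow> (\<forall>k>0. p \<notin> degenerate_set V k)"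

definition generically_minimally_rigid ::
  "('v, 'e) pre_digraph \<Rightarrow> ('e \<Rightarrow> int ^ 'd) \<Rightarrow> bool" where
  "generically_minimally_rigid G m \<longleftrightarrow>
     int (card (arcs G)) = int CARD('d) * int (card (verts G)) - int CARD('d) \<and>
     (\<forall>p. torus_framework G p \<and> generic (verts G) p \<longrightarrow> infinitesimally_rigid G m p)"


section \<open>The gain space\<close>

text \<open>
  Cycles of the undirected multigraph are cycles of the digraph in which every arc \<open>e\<close> is doubled
  to \<open>(e, True)\<close>, traversed along its orientation, and \<open>(e, False)\<close>, traversed against it. The
  condition that the underlying arcs are distinct excludes going back along the arc just used.
  A single loop is a cycle.
\<close>

definition doubled :: "('v, 'e) pre_digraph \<Rightarrow> ('v, 'e \<times> bool) pre_digraph" where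
  "doubled G = \<lparr> verts = verts G, arcs = arcs G \<times> UNIV,
     tail = (\<lambda>(e, b). if b then tail G e else head G e),
     head = (\<lambda>(e, b). if b then head G e else tail G e) \<rparr>"

definition undirected_cycle :: "('v, 'e) pre_digraph \<Rightarrow> ('e \<times> bool) list \<Rightarrow> bool" where
  "undirected_cycle G c \<longleftrightarrow> pre_digraph.cycle (doubled G) c \<and> distinct (map fst c)"

definition net_gain :: "('e \<Rightarrow> int ^ 'd) \<Rightarrow> ('e \<times> bool) list \<Rightarrow> int ^ 'd" where
  "net_gain m c = (\<Sum>(e, b)\<leftarrow>c. if b then m e else - m e)"

global_interpretation int_vec: Modules.module "(*s) :: int \<Rightarrow> int ^ 'd \<Rightarrow> int ^ 'd"
  by unfold_locales (simp_all add: vec_eq_iff algebra_simps)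

definition gain_space ::
  "('v, 'e) pre_digraph \<Rightarrow> ('e \<Rightarrow> int ^ 'd) \<Rightarrow> 'e set \<Rightarrow> (int ^ 'd) set" where
  "gain_space G m Y = int_vec.span {net_gain m c | c. undirected_cycle G c \<and> fst ` set c \<subseteq> Y}"

text \<open>
  The rank of a subgroup of \<open>\<int>\<^sup>d\<close>: the largest number of elements independent over the integers.
\<close>

definition int_rank :: "(int ^ 'd) set \<Rightarrow> nat" where
  "int_rank M = Max {card B | B. finite B \<and> B \<subseteq> M \<and> int_vec.independent B}"

text \<open>
  The subgraph of \<open>Y\<close> lifts to a periodic framework that, for generic \<open>p\<close>, spans an affine space of
  dimension at least \<open>d - 1\<close> if \<open>d \<le> |V(Y)| + k\<close>, where \<open>k\<close> is the rank of the gain space of \<open>Y\<close>. Then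
  the rotations fixing the gain space contribute their full dimension \<open>(d - k) choose 2\<close> to the
  infinitesimal motions, which is what the count
  \<open>d |V(Y)| - ((d + 1) choose 2) + (\<Sum>i = 1..k. d - i) = d |V(Y)| - d - ((d - k) choose 2)\<close>
  expresses. Without that condition the count can fail: for \<open>Y = {}\<close>, and for a single edge if
  \<open>d \<ge> 3\<close>.
\<close>

definition incident_verts :: "('v, 'e) pre_digraph \<Rightarrow> 'e set \<Rightarrow> 'v set" where
  "incident_verts G Y = tail G ` Y \<union> head G ` Y"

end

theory Submission
  imports Defs
begin

text \<open>
  A rigid framework with \<open>d |V| - d\<close> arcs has independent rigidity rows. It therefore suffices to find
  one generic \<open>p\<close> for which the rows of \<open>Y\<close> are orthogonal to a space of motions of dimension
  \<open>d + (d - k choose 2)\<close>. Moving each vertex by a lattice vector brings all gains of \<open>Y\<close> into the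
  gain space. Then the translations and the rotations that fix the gain space pointwise are motions.
  They are independent when the moved points, taken modulo the gain space, span an affine space of
  dimension at least \<open>d - k - 1\<close>. This is a nonvanishing polynomial condition, which can be imposed
  together with the countably many conditions that define genericity.
\<close>

section \<open>Homogeneous linear systems\<close>

text \<open>Gaussian elimination: if the new equation has a nonzero coefficient, the unknown it
  belongs to is eliminated from the other equations, which leaves one equation and one unknown
  fewer. Unknowns and equations are indexed families, so that parallel arcs with equal rows count
  separately.\<close>

lemma underdetermined_system:
  fixes f :: "'j \<Rightarrow> 'i \<Rightarrow> 'a::field"
  assumes "finite I" and "card I < card J"
  shows "\<exists>a. (\<exists>j\<in>J. a j \<noteq> 0) \<and> (\<forall>i\<in>I. (\<Sum>j\<in>J. a j * f j i) = 0)"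
  using assms
proof (induction I arbitrary: J f rule: finite_induct)
  case empty
  then have "J \<noteq> {}" by auto
  then show ?case by (intro exI[of _ "\<lambda>_. 1"]) auto
next
  case (insert i I)
  have fin: "finite J" using insert.prems card.infinite by fastforce
  show ?case
  proof (cases "\<exists>k\<in>J. f k i \<noteq> 0")
    case False
    moreover obtain a where "\<exists>j\<in>J. a j \<noteq> 0" "\<forall>i\<in>I. (\<Sum>j\<in>J. a j * f j i) = 0"
      using insert.IH[of J f] insert.prems insert.hyps by fastforce
    ultimately show ?thesis by (intro exI[of _ a]) auto
  next
    case True
    then obtain k where k: "k \<in> J" "f k i \<noteq> 0" by blast
    define g where "g j l = f j l - f j i / f k i * f k l" for j l
    have "card I < card (J - {k})" using insert k fin by auto
    then obtain a where a: "\<exists>j\<in>J - {k}. a j \<noteq> 0" "\<forall>l\<in>I. (\<Sum>j\<in>J - {k}. a j * g j l) = 0"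
      using insert.IH[of "J - {k}" g] by blast
    \<comment> \<open>Once the other unknowns are given by \<open>a\<close>, equation
      \<open>i\<close> forces the value \<open>- s\<close> on the unknown \<open>k\<close>.\<close>
    define s where "s = (\<Sum>j\<in>J - {k}. a j * f j i) / f k i"
    define b where "b j = (if j = k then - s else a j)" for j
    have b_sum: "(\<Sum>j\<in>J. b j * f j l) = (\<Sum>j\<in>J - {k}. a j * f j l) - s * f k l" for l
    proof -
      have "(\<Sum>j\<in>J - {k}. b j * f j l) = (\<Sum>j\<in>J - {k}. a j * f j l)"
        by (intro sum.cong) (auto simp: b_def)
      then show ?thesis using fin k by (simp add: sum.remove[of J k] b_def)
    qed
    have "(\<Sum>j\<in>J. b j * f j l) = 0" if "l \<in> I" for l
    proof -
      have "0 = (\<Sum>j\<in>J - {k}. a j * g j l)" using a that by simp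
      also have "\<dots> = (\<Sum>j\<in>J - {k}. a j * f j l - a j * f j i * (f k l / f k i))"
        by (intro sum.cong) (auto simp: g_def field_simps)
      also have "\<dots> = (\<Sum>j\<in>J - {k}. a j * f j l) - s * f k l"
        by (simp add: sum_subtractf s_def sum_distrib_right sum_divide_distrib)
      finally show ?thesis using b_sum by simp
    qed
    moreover have "(\<Sum>j\<in>J. b j * f j i) = 0" unfolding b_sum using k by (simp add: s_def)
    moreover have "\<exists>j\<in>J. b j \<noteq> 0" using a by (auto simp: b_def)
    ultimately show ?thesis by (intro exI[of _ b]) auto
  qed
qed

section \<open>Generic configurations as common nonroots of polynomials\<close>

lemma finite_roots_real_polynomial_function:
  fixes f :: "real \<Rightarrow> real"
  assumes "real_polynomial_function f" and "f x \<noteq> 0"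
  shows "finite {t. f t = 0}"
proof -
  obtain a n where f: "f = (\<lambda>t. \<Sum>i\<le>n. a i * t ^ i)"
    using assms(1) real_polynomial_function_iff_sum by metis
  then have "\<exists>i\<le>n. a i \<noteq> 0" using assms(2) by (auto intro: ccontr)
  then show ?thesis unfolding f by (simp add: polyfun_finite_roots)
qed

text \<open>Polynomiality in each variable separately is what the choice of one coordinate at a time
  uses, and it makes sense for index sets of any size.\<close>

definition coordinatewise_polynomial :: "(('i \<Rightarrow> real) \<Rightarrow> real) \<Rightarrow> bool" where
  "coordinatewise_polynomial f \<longleftrightarrow> (\<forall>x i. real_polynomial_function (\<lambda>t. f (x(i := t))))"

lemma real_polynomial_function_fun_upd:
  "real_polynomial_function (\<lambda>t. (x(i := t)) j)" for x :: "'i \<Rightarrow> real"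
  by (cases "j = i") (auto intro: real_polynomial_function.intros(1,2) bounded_linear_ident)

text \<open>
  The coordinates are chosen one after the other. If \<open>f q \<noteq> 0\<close>, then all but finitely many values
  of a coordinate, substituted into \<open>f\<close>, leave a function that does not vanish at \<open>q\<close>.
\<close>

lemma common_nonroot:
  fixes F :: "(('i \<Rightarrow> real) \<Rightarrow> real) set"
  assumes "finite I" and "countable F"
    and "\<And>f. f \<in> F \<Longrightarrow> coordinatewise_polynomial f"
    and "\<And>f x y. f \<in> F \<Longrightarrow> (\<And>i. i \<in> I \<Longrightarrow> x i = y i) \<Longrightarrow> f x = f y"
    and "\<And>f. f \<in> F \<Longrightarrow> \<exists>q. f q \<noteq> 0"
  shows "\<exists>x. (\<forall>i\<in>I. 0 < x i \<and> x i < 1) \<and> (\<forall>f\<in>F. f x \<noteq> 0)"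
  using assms
proof (induction I arbitrary: F rule: finite_induct)
  case empty
  then show ?case by (metis empty_iff)
next
  case (insert i I)
  obtain q where q: "\<And>f. f \<in> F \<Longrightarrow> f (q f) \<noteq> 0" using insert.prems(4) by metis
  \<comment> \<open>Countably many finite root sets cannot cover the interval from which
    \<open>t\<close> is taken.\<close>
  define bad where "bad = (\<Union>f\<in>F. {t. f ((q f)(i := t)) = 0})"
  have "countable {t. f ((q f)(i := t)) = 0}" if "f \<in> F" for f
    using finite_roots_real_polynomial_function[of "\<lambda>t. f ((q f)(i := t))" "q f i"]
      insert.prems(2)[OF that] q[OF that]
    by (auto simp: coordinatewise_polynomial_def intro: countable_finite)
  then have "countable bad" using insert.prems(1) unfolding bad_def by auto
  moreover have "uncountable {0<..<1::real}" by (simp add: uncountable_open_interval)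
  ultimately obtain t where t: "t \<in> {0<..<1}" "t \<notin> bad"
    by (metis countable_subset subsetI)
  define S where "S f = (\<lambda>x. f (x(i := t)))" for f :: "('i \<Rightarrow> real) \<Rightarrow> real"
  have "\<exists>x. (\<forall>i\<in>I. 0 < x i \<and> x i < 1) \<and> (\<forall>f\<in>S ` F. f x \<noteq> 0)"
  proof (rule insert.IH)
    show "countable (S ` F)" using insert.prems(1) by simp
  next
    fix g assume "g \<in> S ` F"
    then obtain f where f: "f \<in> F" "g = S f" by blast
    show "coordinatewise_polynomial g"
      unfolding coordinatewise_polynomial_def
    proof (intro allI)
      fix x j
      show "real_polynomial_function (\<lambda>s. g (x(j := s)))"
      proof (cases "j = i")
        case True
        then show ?thesis by (simp add: f(2) S_def real_polynomial_function.intros(2))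
      next
        case False
        then have "g (x(j := s)) = f ((x(i := t))(j := s))" for s
          by (simp add: f(2) S_def fun_upd_twist)
        then show ?thesis
          using insert.prems(2)[OF f(1)] by (simp add: coordinatewise_polynomial_def)
      qed
    qed
    show "\<exists>q. g q \<noteq> 0" using t(2) f by (auto simp: bad_def S_def)
    show "g x = g y" if "\<And>j. j \<in> I \<Longrightarrow> x j = y j" for x y
      unfolding f(2) S_def by (rule insert.prems(3)[OF f(1)]) (auto simp: that)
  qed
  then obtain x where x: "\<forall>j\<in>I. 0 < x j \<and> x j < 1" "\<forall>f\<in>F. f (x(i := t)) \<noteq> 0"
    by (auto simp: S_def)
  then have "\<forall>j\<in>insert i I. 0 < (x(i := t)) j \<and> (x(i := t)) j < 1" using t(1) by auto
  then show ?case using x(2) by blast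
qed

text \<open>The Leibniz formula is a finite sum of products of entries. This serves both the
  rigidity minors and the determinant that expresses the spanning condition.\<close>

lemma real_polynomial_function_det:
  fixes A :: "'a::real_normed_vector \<Rightarrow> nat \<times> nat \<Rightarrow> real"
  assumes "\<And>i j. i < n \<Longrightarrow> j < n \<Longrightarrow> real_polynomial_function (\<lambda>t. A t (i, j))"
  shows "real_polynomial_function (\<lambda>t. Determinant.det (Matrix.mat n n (A t)))"
proof -
  have perm: "p i < n" if "p permutes {0..<n}" "i < n" for p i
    using permutes_in_image[OF that(1), of i] that(2) by simp
  have "Determinant.det (Matrix.mat n n (A t)) =
      (\<Sum>p\<in>{p. p permutes {0..<n}}. signof p * (\<Prod>i = 0..<n. A t (i, p i)))" for t
    by (subst Determinant.det_def'[where n = n])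
      (auto intro!: sum.cong prod.cong arg_cong2[where f = "(*)"] simp: perm)
  moreover have "real_polynomial_function
      (\<lambda>t. \<Sum>p\<in>{p. p permutes {0..<n}}. signof p * (\<Prod>i = 0..<n. A t (i, p i)))"
    by (intro real_polynomial_function_sum real_polynomial_function.intros(4)
        real_polynomial_function.intros(2) real_polynomial_function_prod finite_permutations assms)
      (auto simp: perm)
  ultimately show ?thesis by simp
qed

lemma countable_UNIV_int_vec: "countable (UNIV :: (int ^ 'd) set)"
proof (rule countable_image_inj_on)
  show "inj ((\<lambda>z c. z $ c) :: int ^ 'd \<Rightarrow> 'd \<Rightarrow> int)"
    by (intro injI) (simp add: Finite_Cartesian_Product.vec_eq_iff fun_eq_iff)
  have "countable (Pi\<^sub>E (UNIV :: 'd set) (\<lambda>_. UNIV :: int set))"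
    by (intro countable_PiE) auto
  then show "countable (range ((\<lambda>z c. z $ c) :: int ^ 'd \<Rightarrow> 'd \<Rightarrow> int))"
    by (rule countable_subset[rotated]) auto
qed

text \<open>Genericity, injectivity and \<open>f p \<noteq> 0\<close> all follow from avoiding the
  zero sets of countably many polynomials, and a common nonroot can be found with all coordinates
  strictly between 0 and 1.\<close>

lemma generic_torus_framework_nonroot:
  fixes f :: "('v \<Rightarrow> real ^ 'd) \<Rightarrow> real"
  assumes V: "finite V"
    and poly: "coordinatewise_polynomial (\<lambda>x. f (\<lambda>v. \<chi> c. x (v, c)))"
    and dep: "\<And>p q. (\<And>v. v \<in> V \<Longrightarrow> p v = q v) \<Longrightarrow> f p = f q"
    and nz: "f r \<noteq> 0"
  obtains p where "inj_on p V" "\<forall>v\<in>V. \<forall>c. 0 \<le> p v $ c \<and> p v $ c < 1"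
    "generic V p" "f p \<noteq> 0"
proof -
  define conf :: "('v \<times> 'd \<Rightarrow> real) \<Rightarrow> 'v \<Rightarrow> real ^ 'd" where "conf x = (\<lambda>v. \<chi> c. x (v, c))" for x
  have conf_onto: "conf (\<lambda>(v, c). p v $ c) = p" for p by (simp add: conf_def)
  have entry: "real_polynomial_function (\<lambda>t. rigidity_entry (conf (x(i := t))) e k)" for x i e k
  proof -
    obtain v w z y c where e: "e = (v, w, z)" "k = (y, c)" by (metis prod.exhaust)
    have eq: "rigidity_entry (conf (x(i := t))) e k =
        (of_bool (y = v) - of_bool (y = w)) *
        ((x(i := t)) (v, c) - (x(i := t)) (w, c) - real_gain z $ c)" for t
      by (auto simp: e rigidity_entry_def conf_def)
    show ?thesis
      unfolding eq
      by (intro real_polynomial_function.intros(2,4) real_polynomial_function_diff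
          real_polynomial_function_fun_upd)
  qed
  \<comment> \<open>This family contains the minors of every \<open>degenerate_set V k\<close>, so
    avoiding it settles all \<open>k\<close> at once. It is countable because the gains range over a
    countable set.\<close>
  define T :: "(('v \<times> 'v \<times> (int ^ 'd)) list \<times> ('v \<times> 'd) list) set" where "T = {(es, cs).
    set es \<subseteq> V \<times> V \<times> UNIV \<and> set cs \<subseteq> V \<times> UNIV \<and> length cs = length es \<and>
    (\<exists>q. rigidity_minor es cs q \<noteq> 0)}"
  \<comment> \<open>For injectivity it is enough that two points differ in one coordinate;
    \<open>undefined\<close> is an arbitrary fixed one.\<close>
  define F where "F = insert (\<lambda>x. f (conf x)) ((\<lambda>(es, cs) x. rigidity_minor es cs (conf x)) ` T \<union>
    (\<lambda>(v, w) x. (conf x v - conf x w) $ undefined) ` (V \<times> V \<inter> {(v, w). v \<noteq> w}))"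
  have "countable (lists (V \<times> V \<times> (UNIV :: (int ^ 'd) set)))"
    using V by (intro countable_lists countable_SIGMA countable_finite countable_UNIV_int_vec)
  moreover have "countable (lists (V \<times> (UNIV :: 'd set)))"
    using V by (intro countable_lists countable_finite) simp
  ultimately have "countable T"
    by (rule_tac countable_subset[OF _ countable_SIGMA]) (auto simp: T_def)
  then have count: "countable F"
    using V by (simp add: F_def countable_finite)
  have "\<exists>x. (\<forall>i\<in>V \<times> UNIV. 0 < x i \<and> x i < 1) \<and> (\<forall>g\<in>F. g x \<noteq> 0)"
  proof (rule common_nonroot[OF _ count])
    show "finite (V \<times> (UNIV :: 'd set))" using V by simp
  next
    fix g assume "g \<in> F"
    then consider "g = (\<lambda>x. f (conf x))"
      | es cs where "(es, cs) \<in> T" "g = (\<lambda>x. rigidity_minor es cs (conf x))"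
      | v w where "v \<in> V" "w \<in> V" "v \<noteq> w" "g = (\<lambda>x. (conf x v - conf x w) $ undefined)"
      unfolding F_def by auto
    note g = this
    show "coordinatewise_polynomial g" using g
    proof cases
      case 1
      then show ?thesis using poly by (simp add: conf_def)
    next
      case 2
      show ?thesis
        unfolding 2(2) coordinatewise_polynomial_def rigidity_minor_def
        by (intro allI real_polynomial_function_det) (simp add: entry)
    next
      case 3
      show ?thesis
        unfolding 3(4) coordinatewise_polynomial_def
        by (simp add: conf_def del: fun_upd_apply)
          (intro allI real_polynomial_function_diff real_polynomial_function_fun_upd)
    qed
    show "\<exists>q. g q \<noteq> 0" using g
    proof cases
      case 1
      then show ?thesis using nz conf_onto by metis
    next
      case 2
      then show ?thesis unfolding T_def using conf_onto by clarsimp metis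
    next
      case 3
      then show ?thesis
        by (intro exI[of _ "\<lambda>(u, c). if u = v then 1 else 0"]) (simp add: conf_def)
    qed
    show "g x = g y" if xy: "\<And>i. i \<in> V \<times> UNIV \<Longrightarrow> x i = y i" for x y
    proof -
      have eq: "conf x v = conf y v" if "v \<in> V" for v using xy that by (simp add: conf_def)
      show ?thesis using g
      proof cases
        case 1
        then show ?thesis using dep eq by metis
      next
        case 2
        then have entries: "rigidity_entry (conf x) (es ! i) k = rigidity_entry (conf y) (es ! i) k"
          if "i < length es" for i k
          using nth_mem[OF that]
          by (cases "es ! i"; cases k) (auto simp: T_def rigidity_entry_def eq)
        show ?thesis
          unfolding 2(2) rigidity_minor_def
          by (intro arg_cong[where f = Determinant.det] cong_mat refl) (simp add: entries)
      next
        case 3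
        then show ?thesis using eq by simp
      qed
    qed
  qed
  then obtain x where x: "\<And>v c. v \<in> V \<Longrightarrow> 0 < x (v, c) \<and> x (v, c) < 1" "\<And>g. g \<in> F \<Longrightarrow> g x \<noteq> 0"
    by auto
  show thesis
  proof (rule that[of "conf x"])
    show "\<forall>v\<in>V. \<forall>c. 0 \<le> conf x v $ c \<and> conf x v $ c < 1"
      using x(1) by (simp add: conf_def less_imp_le)
    show "f (conf x) \<noteq> 0" using x(2)[of "\<lambda>x. f (conf x)"] by (simp add: F_def)
    show "inj_on (conf x) V"
    proof (rule inj_onI, rule ccontr)
      fix v w assume "v \<in> V" "w \<in> V" "conf x v = conf x w" "v \<noteq> w"
      then have "(\<lambda>x. (conf x v - conf x w) $ undefined) \<in> F"
        unfolding F_def by (intro insertI2 UnI2 image_eqI[of _ _ "(v, w)"]) auto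
      then show False using x(2) \<open>conf x v = conf x w\<close> by fastforce
    qed
    show "generic V (conf x)"
      unfolding generic_def
    proof (intro allI impI notI)
      fix k :: nat
      assume "conf x \<in> degenerate_set V k"
      then obtain es cs where "rigidity_minor es cs (conf x) = 0" "(es, cs) \<in> T"
        unfolding degenerate_set_def T_def gain_edges_def by (auto; blast)
      then show False using x(2)[of "\<lambda>x. rigidity_minor es cs (conf x)"] by (force simp: F_def)
    qed
  qed
qed

section \<open>Independence of the rigidity rows\<close>

text \<open>Connects the matrix, whose columns are pairs of a vertex and a coordinate, with the edge
  equations that define infinitesimal motions.\<close>

lemma sum_rigidity_entry:
  fixes p u :: "'v \<Rightarrow> real ^ 'd"
  assumes "finite V" and "v \<in> V" and "w \<in> V"
  shows "(\<Sum>k\<in>V \<times> UNIV. rigidity_entry p (v, w, z) k * u (fst k) $ snd k) =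
    inner (u v - u w) (p v - p w - real_gain z)"
proof -
  define D where "D = p v - p w - real_gain z"
  have entry: "rigidity_entry p (v, w, z) k =
      (if fst k = v then D $ snd k else 0) - (if fst k = w then D $ snd k else 0)" for k
    by (cases k) (simp add: rigidity_entry_def D_def)
  have "(\<Sum>k\<in>V \<times> UNIV. rigidity_entry p (v, w, z) k * u (fst k) $ snd k) =
      (\<Sum>x\<in>V. \<Sum>c\<in>UNIV. ((if x = v then D $ c else 0) - (if x = w then D $ c else 0)) * u x $ c)"
    by (simp add: sum.cartesian_product split_def entry)
  also have "\<dots> = (\<Sum>x\<in>V. (if x = v then inner D (u x) else 0) - (if x = w then inner D (u x) else 0))"
    by (intro sum.cong) (auto simp: inner_vec_def sum_negf)
  also have "\<dots> = inner D (u v) - inner D (u w)"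
    using assms by (simp add: sum_subtractf sum.delta')
  finally show ?thesis by (simp add: D_def inner_commute inner_diff_right)
qed

text \<open>The equations of the arcs other than \<open>e0\<close>, together with the
  \<open>d\<close> equations that pin \<open>v0\<close> at the origin, are fewer than the
  \<open>d |V|\<close> unknowns, so they have a nonzero solution \<open>u\<close>. If
  \<open>a e0 \<noteq> 0\<close>, the relation makes \<open>u\<close> satisfy the equation of
  \<open>e0\<close> too. Rigidity then makes this motion constant, hence zero, a
  contradiction.\<close>

lemma rigid_imp_independent:
  fixes G :: "('v, 'e) pre_digraph" and m :: "'e \<Rightarrow> int ^ 'd"
  assumes "fin_digraph G"
    and card: "int (card (arcs G)) = int CARD('d) * int (card (verts G)) - int CARD('d)"
    and v0: "v0 \<in> verts G"
    and rigid: "infinitesimally_rigid G m p"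
    and a: "\<And>k. k \<in> verts G \<times> UNIV \<Longrightarrow>
      (\<Sum>e\<in>arcs G. a e * rigidity_entry p (tail G e, head G e, m e) k) = 0"
    and e0: "e0 \<in> arcs G"
  shows "a e0 = 0"
proof (rule ccontr)
  assume a0: "a e0 \<noteq> 0"
  interpret fin_digraph G by fact
  let ?K = "verts G \<times> (UNIV :: 'd set)"
  define r where "r e = rigidity_entry p (tail G e, head G e, m e)" for e
  define I :: "('e + 'd) set" where "I = Inl ` (arcs G - {e0}) \<union> range Inr"
  define f :: "'v \<times> 'd \<Rightarrow> 'e + 'd \<Rightarrow> real" where
    "f k i = (case i of Inl e \<Rightarrow> r e k | Inr c \<Rightarrow> if k = (v0, c) then 1 else 0)" for k i
  have "card I = card (arcs G) - 1 + CARD('d)"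
    unfolding I_def using e0 by (subst card_Un_disjoint) (auto simp: card_image)
  moreover have "card (arcs G) > 0" using e0 by (auto simp: card_gt_0_iff)
  ultimately have "int (card I) < int (card ?K)"
    using card by (simp add: card_cartesian_product)
  then have lt: "card I < card ?K" by presburger
  have "finite I" by (simp add: I_def)
  then obtain b where b: "\<exists>k\<in>?K. b k \<noteq> 0" "\<And>i. i \<in> I \<Longrightarrow> (\<Sum>k\<in>?K. b k * f k i) = 0"
    using underdetermined_system[OF _ lt, of f] by blast
  define u :: "'v \<Rightarrow> real ^ 'd" where "u x = (\<chi> c. b (x, c))" for x
  have inner_r: "inner (u (tail G e) - u (head G e)) (p (tail G e) - p (head G e) - real_gain (m e)) =
      (\<Sum>k\<in>?K. b k * r e k)" if "e \<in> arcs G" for e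
    using sum_rigidity_entry[OF finite_verts, of "tail G e" "head G e" p "m e" u] that
    by (simp add: u_def r_def mult.commute)
  have others: "(\<Sum>k\<in>?K. b k * r e k) = 0" if "e \<in> arcs G - {e0}" for e
    using b(2)[of "Inl e"] that by (simp add: I_def f_def)
  \<comment> \<open>Pairing the row relation with \<open>b\<close> kills every term except that of
    \<open>e0\<close>.\<close>
  have "0 = (\<Sum>k\<in>?K. b k * (\<Sum>e\<in>arcs G. a e * r e k))"
    using a by (intro sum.neutral[symmetric]) (auto simp: r_def)
  also have "\<dots> = (\<Sum>e\<in>arcs G. a e * (\<Sum>k\<in>?K. b k * r e k))"
    unfolding sum_distrib_left by (subst sum.swap) (simp add: mult.left_commute)
  also have "\<dots> = a e0 * (\<Sum>k\<in>?K. b k * r e0 k)"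
    using others e0 by (subst sum.remove[of _ e0]) auto
  finally have "(\<Sum>k\<in>?K. b k * r e0 k) = 0" using a0 by simp
  then have "(\<Sum>k\<in>?K. b k * r e k) = 0" if "e \<in> arcs G" for e
    using others that by (cases "e = e0") auto
  then have "infinitesimal_motion G m p u"
    unfolding infinitesimal_motion_def using inner_r by simp
  then have eq: "u x = u v0" if "x \<in> verts G" for x
    using rigid v0 that unfolding infinitesimally_rigid_def by blast
  have "u v0 $ c = 0" for c
    using b(2)[of "Inr c"] v0 by (simp add: I_def f_def u_def if_distrib sum.delta' cong: if_cong)
  then have "b k = 0" if "k \<in> ?K" for k
    using eq[of "fst k"] that by (auto simp: u_def Finite_Cartesian_Product.vec_eq_iff)
  then show False using b(1) by blast
qed

section \<open>Integer rank and real dimension\<close>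

text \<open>The product \<open>n\<close> of all denominators turns a rational relation into an
  integral one.\<close>

lemma int_independent_imp_rat_independent:
  fixes B :: "(int ^ 'd) set"
  assumes ind: "int_vec.independent B" and fin: "finite B"
    and rel: "\<And>c. (\<Sum>b\<in>B. q b * of_int (b $ c)) = (0 :: rat)"
    and b: "b \<in> B"
  shows "q b = 0"
proof -
  define n where "n = (\<Prod>b\<in>B. snd (quotient_of (q b)))"
  have "snd (quotient_of (q b)) > 0" for b by (rule quotient_of_denom_pos')
  then have n: "n > 0" by (simp add: n_def prod_pos)
  have "\<exists>k. of_int n * q x = of_int k" if "x \<in> B" for x
  proof -
    have "snd (quotient_of (q x)) dvd n" unfolding n_def using that fin by (rule dvd_prodI[rotated])
    then obtain l where l: "n = snd (quotient_of (q x)) * l" by blast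
    have "q x = of_int (fst (quotient_of (q x))) / of_int (snd (quotient_of (q x)))"
      by (rule quotient_of_div) simp
    then have "of_int (snd (quotient_of (q x))) * q x = of_int (fst (quotient_of (q x)))"
      using \<open>\<And>b. snd (quotient_of (q b)) > 0\<close>[of x]
      by (metis less_irrefl nonzero_mult_div_cancel_left of_int_0_eq_iff times_divide_eq_right)
    then have "of_int n * q x = of_int (l * fst (quotient_of (q x)))"
      by (simp add: l mult_ac)
    then show ?thesis by blast
  qed
  then obtain k where k: "\<And>x. x \<in> B \<Longrightarrow> of_int n * q x = of_int (k x)" by metis
  have "(\<Sum>x\<in>B. k x *s x) = 0"
  proof -
    have zero: "(\<Sum>x\<in>B. k x *s x) $ c = 0" for c
    proof -
      have "of_int ((\<Sum>x\<in>B. k x *s x) $ c) = (\<Sum>x\<in>B. of_int (k x) * of_int (x $ c) :: rat)"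
        by (simp add: sum_component)
      also have "\<dots> = of_int n * (\<Sum>x\<in>B. q x * of_int (x $ c))"
        unfolding sum_distrib_left by (intro sum.cong) (simp_all flip: k)
      finally show ?thesis using rel[of c] by (metis mult_zero_right of_int_eq_0_iff)
    qed
    show ?thesis by (simp only: Finite_Cartesian_Product.vec_eq_iff zero zero_index simp_thms)
  qed
  then have "k b = 0"
    using ind fin b unfolding int_vec.dependent_explicit by blast
  then show ?thesis using k[OF b] n by simp
qed

lemma real_gain_simps:
  "real_gain 0 = 0" "real_gain (x + y) = real_gain x + real_gain y"
  "real_gain (- x) = - real_gain x" "real_gain (x - y) = real_gain x - real_gain y"
  "real_gain (k *s x) = of_int k *\<^sub>R real_gain x"
  by (simp_all add: real_gain_def Finite_Cartesian_Product.vec_eq_iff)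

lemma real_gain_sum: "real_gain (sum f A) = (\<Sum>x\<in>A. real_gain (f x))"
  by (induction A rule: infinite_finite_induct) (simp_all add: real_gain_simps)

lemma inj_real_gain: "inj real_gain"
  by (intro injI) (simp add: real_gain_def Finite_Cartesian_Product.vec_eq_iff)

text \<open>
  A real linear relation between integer vectors is turned into a rational one by a \<open>\<rat>\<close>-linear
  functional on \<open>\<real>\<close> that does not vanish on one of the coefficients.
\<close>

lemma independent_real_gain_image:
  fixes B :: "(int ^ 'd) set"
  assumes ind: "int_vec.independent B" and fin: "finite B"
  shows "independent (real_gain ` B)"
proof (rule ccontr)
  assume "\<not> independent (real_gain ` B)"
  then obtain u b where u: "(\<Sum>x\<in>real_gain ` B. u x *\<^sub>R x) = 0" "b \<in> B" "u (real_gain b) \<noteq> 0"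
    using fin by (auto simp: real_vector.dependent_finite)
  define a where "a x = u (real_gain x)" for x
  have a: "(\<Sum>x\<in>B. a x *\<^sub>R real_gain x) = 0"
    using u(1) sum.reindex[OF inj_on_subset[OF inj_real_gain], of B "\<lambda>x. u x *\<^sub>R x"] by (simp add: a_def)
  \<comment> \<open>Here the reals form a rational vector space. The nonzero number
    \<open>a b\<close> is independent in it, so prescribing the value 1 there extends to a linear
    \<open>\<phi>\<close>.\<close>
  interpret Q: vector_space_pair "\<lambda>(q :: rat) (x :: real). of_rat q * x" "(*) :: rat \<Rightarrow> rat \<Rightarrow> rat"
    by unfold_locales (simp_all add: algebra_simps of_rat_add of_rat_mult)
  have "Q.vs1.independent {a b}"
    using u(3) by (simp add: Q.vs1.independent_insert a_def)
  then obtain \<phi> where \<phi>: "Vector_Spaces.linear (\<lambda>(q :: rat) (x :: real). of_rat q * x) (*) \<phi>" "\<phi> (a b) = 1"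
    using Q.linear_independent_extend[of "{a b}" "\<lambda>_. 1"] by blast
  have scale: "\<phi> (of_int k * y) = of_int k * \<phi> y" for k y
    using Q.linear_scale[OF \<phi>(1), of "of_int k" y] by simp
  have "(\<Sum>x\<in>B. \<phi> (a x) * of_int (x $ c)) = 0" for c
  proof -
    have "(\<Sum>x\<in>B. \<phi> (a x) * of_int (x $ c)) = (\<Sum>x\<in>B. \<phi> (of_int (x $ c) * a x))"
      unfolding scale by (simp only: mult.commute)
    also have "\<dots> = \<phi> (\<Sum>x\<in>B. of_int (x $ c) * a x)"
      by (simp add: Q.linear_sum[OF \<phi>(1)])
    also have "(\<Sum>x\<in>B. of_int (x $ c) * a x) = (\<Sum>x\<in>B. a x *\<^sub>R real_gain x) $ c"
      by (simp add: sum_component real_gain_def mult.commute)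
    finally show ?thesis using a Q.linear_0[OF \<phi>(1)] by simp
  qed
  then have "\<phi> (a b) = 0"
    using int_independent_imp_rat_independent[OF ind fin, of "\<lambda>x. \<phi> (a x)"] u(2) by blast
  then show False using \<phi>(2) by simp
qed

text \<open>Independence over the integers and over the reals agree for integer vectors:
  \<open>independent_real_gain_image\<close> gives one direction, and an integer relation is in
  particular a real one. The bound by the dimension also shows that the maximum is over a finite
  set.\<close>

lemma int_rank_eq_dim:
  fixes M :: "(int ^ 'd) set"
  shows "int_rank M = dim (real_gain ` M)"
proof -
  let ?S = "{card B | B. finite B \<and> B \<subseteq> M \<and> int_vec.independent B}"
  have le: "k \<le> dim (real_gain ` M)" if k: "k \<in> ?S" for k
  proof -
    obtain B where B: "k = card B" "finite B" "B \<subseteq> M" "int_vec.independent B" using k by blast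
    have "card B = card (real_gain ` B)"
      by (metis card_image inj_on_subset inj_real_gain subset_UNIV)
    also have "\<dots> \<le> dim (real_gain ` M)"
      using B by (intro independent_card_le_dim independent_real_gain_image) auto
    finally show ?thesis using B by simp
  qed
  obtain C where C: "C \<subseteq> real_gain ` M" "independent C" "card C = dim (real_gain ` M)"
    by (metis basis_exists)
  \<comment> \<open>A real basis chosen within the image of \<open>M\<close> pulls back to a subset
    of \<open>M\<close>.\<close>
  then obtain B where B: "B \<subseteq> M" "C = real_gain ` B" by (meson subset_image_iff)
  have inj: "inj_on real_gain B" by (metis inj_on_subset inj_real_gain subset_UNIV)
  have fin: "finite B" using C(2) B(2) finite_imageD[OF _ inj] independent_imp_finite by blast
  have "int_vec.independent B"
  proof (rule ccontr)
    assume "\<not> int_vec.independent B"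
    then obtain u b t where u: "t \<subseteq> B" "finite t" "(\<Sum>x\<in>t. u x *s x) = 0" "b \<in> t" "u b \<noteq> 0"
      unfolding int_vec.dependent_explicit by blast
    have "(\<Sum>x\<in>t. of_int (u x) *\<^sub>R real_gain x) = 0"
      using arg_cong[OF u(3), of real_gain] by (simp add: real_gain_sum real_gain_simps)
    then have "(\<Sum>y\<in>real_gain ` t. of_int (u (the_inv real_gain y)) *\<^sub>R y) = 0"
      by (subst sum.reindex[OF inj_on_subset[OF inj u(1)]])
        (simp add: the_inv_f_f[OF inj_real_gain])
    moreover have "of_int (u (the_inv real_gain (real_gain b))) \<noteq> (0 :: real)"
      using u(5) by (simp add: the_inv_f_f[OF inj_real_gain])
    ultimately have "dependent (real_gain ` B)"
      unfolding dependent_explicit using u(1,2,4)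
      by (intro exI[of _ "real_gain ` t"] exI[of _ "\<lambda>y. of_int (u (the_inv real_gain y))"]) auto
    then show False using C(2) B(2) by simp
  qed
  then have "dim (real_gain ` M) \<in> ?S"
    using B fin C(3) inj by (auto simp: card_image intro!: exI[of _ B])
  moreover have "finite ?S" using le by (meson finite_nat_set_iff_bounded_le)
  ultimately show ?thesis unfolding int_rank_def using le by (intro Max_eqI) auto
qed

section \<open>Gain spaces and potentials\<close>

lemma gain_space_mono: "Y \<subseteq> Z \<Longrightarrow> gain_space G m Y \<subseteq> gain_space G m Z"
  unfolding gain_space_def by (intro int_vec.span_mono) blast

text \<open>Its walks are the undirected walks along arcs of \<open>Y\<close>. All vertices of
  \<open>G\<close> are kept, so that reachability can be asked for the endpoints of an arc outside
  \<open>Y\<close>.\<close>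

definition restrict_doubled :: "('v, 'e) pre_digraph \<Rightarrow> 'e set \<Rightarrow> ('v, 'e \<times> bool) pre_digraph" where
  "restrict_doubled G Y = (doubled G)\<lparr>arcs := Y \<times> UNIV\<rparr>"

lemma restrict_doubled_simps [simp]:
  "verts (restrict_doubled G Y) = verts G"
  "arcs (restrict_doubled G Y) = Y \<times> UNIV"
  "tail (restrict_doubled G Y) = tail (doubled G)"
  "head (restrict_doubled G Y) = head (doubled G)"
  by (simp_all add: restrict_doubled_def doubled_def)

lemma doubled_simps:
  "tail (doubled G) (e, b) = (if b then tail G e else head G e)"
  "head (doubled G) (e, b) = (if b then head G e else tail G e)"
  by (simp_all add: doubled_def)

lemma wf_digraph_restrict_doubled:
  assumes "wf_digraph G" and "Y \<subseteq> arcs G"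
  shows "wf_digraph (restrict_doubled G Y)"
  using assms by (auto simp: wf_digraph_def doubled_simps)

text \<open>Using the arc of the first step again, in either direction, would revisit the vertex
  where the path starts. This supplies the distinctness of arcs that \<open>undirected_cycle\<close>
  demands.\<close>

lemma distinct_fst_apath:
  assumes wf: "wf_digraph G" and Y: "Y \<subseteq> arcs G"
    and "pre_digraph.apath (restrict_doubled G Y) u c v"
  shows "distinct (map fst c)"
  using assms(3)
proof (induction c arbitrary: u)
  case Nil
  then show ?case by simp
next
  case (Cons a c)
  interpret H: wf_digraph "restrict_doubled G Y" by (rule wf_digraph_restrict_doubled[OF wf Y])
  obtain e b where a: "a = (e, b)" by (cases a)
  have c: "H.apath (head (doubled G) a) c v"
    "tail (doubled G) a \<notin> set (H.awalk_verts (head (doubled G) a) c)"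
    using Cons.prems by (auto simp: H.apath_Cons_iff)
  have "(e, b') \<notin> set c" for b'
  proof
    assume *: "(e, b') \<in> set c"
    have "H.awalk (head (doubled G) a) c v" using c(1) by (simp add: H.apath_def)
    from H.awalk_verts_arc1[OF *] H.awalk_verts_arc2[OF this *] c(2)
    show False by (cases b; cases b') (auto simp: a doubled_simps)
  qed
  then show ?case using Cons.IH[OF c(1)] by (auto simp: a)
qed

text \<open>
  Gains are exact up to the gain space: adding the arcs one by one, an arc that joins two components
  fixes the potential of one of them relative to the other, and an arc within a component closes a
  cycle.
\<close>

lemma exists_potential:
  fixes G :: "('v, 'e) pre_digraph" and m :: "'e \<Rightarrow> int ^ 'd"
  assumes wf: "wf_digraph G" and "finite Y" and "Y \<subseteq> arcs G"
  shows "\<exists>q. \<forall>e\<in>Y. m e - q (tail G e) + q (head G e) \<in> gain_space G m Y"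
  using assms(2,3)
proof (induction Y rule: finite_induct)
  case empty
  then show ?case by simp
next
  case (insert e Y)
  interpret wf_digraph G by fact
  have Y: "Y \<subseteq> arcs G" and e: "e \<in> arcs G" using insert.prems by auto
  interpret H: wf_digraph "restrict_doubled G Y" by (rule wf_digraph_restrict_doubled[OF wf Y])
  let ?M = "gain_space G m (insert e Y)"
  obtain q where q: "\<And>e'. e' \<in> Y \<Longrightarrow> m e' - q (tail G e') + q (head G e') \<in> ?M"
    using insert.IH[OF Y] gain_space_mono[of Y "insert e Y" G m] by blast
  let ?R = "\<lambda>x y. x \<rightarrow>\<^sup>*\<^bsub>restrict_doubled G Y\<^esub> y"
  show ?case
  proof (cases "?R (head G e) (tail G e)")
    case False
    \<comment> \<open>Raising the potential by \<open>\<delta>\<close> on the component of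
      \<open>head G e\<close> makes the defect of \<open>e\<close> zero. An arc of \<open>Y\<close>
      has both ends inside or both outside that component, so its defect is unchanged.\<close>
    define \<delta> where "\<delta> = q (tail G e) - q (head G e) - m e"
    define q' where "q' x = (if ?R (head G e) x then q x + \<delta> else q x)" for x
    have "q' (tail G e') - q' (head G e') = q (tail G e') - q (head G e')" if "e' \<in> Y" for e'
    proof -
      have "H.awalk (tail G e') [(e', True)] (head G e')" "H.awalk (head G e') [(e', False)] (tail G e')"
        using that Y by (auto simp: H.awalk_Cons_iff H.awalk_Nil_iff doubled_simps)
      then have "?R (head G e) (tail G e') \<longleftrightarrow> ?R (head G e) (head G e')"
        by (meson H.reachable_awalkI H.reachable_trans)
      then show ?thesis by (simp add: q'_def)
    qed
    then have "m e' - q' (tail G e') + q' (head G e') \<in> ?M" if "e' \<in> Y" for e'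
      using q[OF that] that by (metis (no_types, lifting) diff_diff_eq2 diff_add_eq diff_diff_add)
    moreover have "m e - q' (tail G e) + q' (head G e) = 0"
      using False e by (simp add: q'_def \<delta>_def H.reachable_refl)
    moreover have "0 \<in> ?M" by (simp add: gain_space_def int_vec.span_zero)
    ultimately show ?thesis by (intro exI[of _ q']) auto
  next
    case True
    then obtain c where c: "H.apath (head G e) c (tail G e)"
      by (metis H.reachable_awalk H.apath_awalk_to_apath)
    then have walk: "H.awalk (head G e) c (tail G e)" by (simp add: H.apath_def)
    have cas: "pre_digraph.cas (restrict_doubled G Y) u c v = pre_digraph.cas (doubled G) u c v" for u v c
      by (induction c arbitrary: u) (simp_all add: pre_digraph.cas.simps)
    have verts: "H.awalk_verts u c = pre_digraph.awalk_verts (doubled G) u c" for u c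
      by (induction c arbitrary: u) (simp_all add: pre_digraph.awalk_verts.simps)
    \<comment> \<open>The path runs within \<open>Y\<close> from the head of \<open>e\<close> back
      to its tail, and \<open>e\<close> is not in \<open>Y\<close>. For a loop \<open>e\<close> the
      path \<open>c\<close> is empty.\<close>
    have "undirected_cycle G ((e, True) # c)"
      unfolding undirected_cycle_def
    proof
      have "pre_digraph.awalk (doubled G) (tail G e) ((e, True) # c) (tail G e)"
        using walk e Y unfolding pre_digraph.awalk_def H.awalk_def
        by (auto simp: cas pre_digraph.cas.simps doubled_simps) (auto simp: doubled_def)
      moreover have "distinct (tl (pre_digraph.awalk_verts (doubled G) (tail G e) ((e, True) # c)))"
        using c by (simp add: pre_digraph.awalk_verts.simps H.apath_def verts doubled_simps)
      ultimately show "pre_digraph.cycle (doubled G) ((e, True) # c)"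
        unfolding pre_digraph.cycle_def by blast
      have "e \<notin> fst ` set c" using walk insert.hyps by (auto simp: H.awalk_def)
      then show "distinct (map fst ((e, True) # c))"
        using distinct_fst_apath[OF wf Y c] by simp
    qed
    moreover have "fst ` set ((e, True) # c) \<subseteq> insert e Y" using walk by (auto simp: H.awalk_def)
    ultimately have cycle: "net_gain m ((e, True) # c) \<in> ?M"
      unfolding gain_space_def by (intro int_vec.span_base) blast
    \<comment> \<open>Along a walk the potential differences telescope, so its net gain agrees with
      that between its ends modulo the gain space. Subtracting this from the net gain of the cycle
      leaves the defect of \<open>e\<close>.\<close>
    have path: "net_gain m c - q u + q v \<in> ?M" if "H.awalk u c v" for u v c
      using that
    proof (induction c arbitrary: u)
      case Nil
      then show ?case by (simp add: H.awalk_Nil_iff net_gain_def gain_space_def int_vec.span_zero)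
    next
      case (Cons a c)
      obtain e' b where a: "a = (e', b)" by (cases a)
      let ?w = "head (doubled G) a"
      have "e' \<in> Y" and u: "u = tail (doubled G) a" and w: "H.awalk ?w c v"
        using Cons.prems by (auto simp: H.awalk_Cons_iff a)
      let ?z = "m e' - q (tail G e') + q (head G e')"
      have "?z \<in> ?M" "- ?z \<in> ?M"
        using q[OF \<open>e' \<in> Y\<close>] int_vec.span_neg unfolding gain_space_def by blast+
      then have "(if b then ?z else - ?z) \<in> ?M" by (cases b) (simp_all only: if_True if_False)
      then have "(if b then ?z else - ?z) + (net_gain m c - q ?w + q v) \<in> ?M"
        using Cons.IH[OF w] unfolding gain_space_def by (rule int_vec.span_add)
      moreover have "net_gain m (a # c) - q u + q v = (if b then ?z else - ?z) + (net_gain m c - q ?w + q v)"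
        by (simp add: net_gain_def a u doubled_simps algebra_simps)
      ultimately show ?case by (simp only:)
    qed
    have "m e - q (tail G e) + q (head G e) =
        net_gain m ((e, True) # c) - (net_gain m c - q (head G e) + q (tail G e))"
      by (simp add: net_gain_def)
    then have "m e - q (tail G e) + q (head G e) \<in> ?M"
      using int_vec.span_diff[OF cycle[unfolded gain_space_def] path[OF walk, unfolded gain_space_def]]
      by (simp only: gain_space_def)
    then show ?thesis using q by blast
  qed
qed

section \<open>Dimension count for orthogonal families\<close>

text \<open>Otherwise the joint family has a nontrivial relation. It splits as
  \<open>y + z = 0\<close> with \<open>y\<close> and \<open>z\<close> orthogonal, so
  \<open>z\<close> is orthogonal to itself. Both parts vanish, against the independence of each
  family.\<close>

lemma card_orthogonal_families:
  fixes f :: "'e \<Rightarrow> 'k \<Rightarrow> real" and g :: "'t \<Rightarrow> 'k \<Rightarrow> real"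
  assumes fin: "finite K" "finite Y" "finite T"
    and orth: "\<And>e s. e \<in> Y \<Longrightarrow> s \<in> T \<Longrightarrow> (\<Sum>k\<in>K. f e k * g s k) = 0"
    and f_ind: "\<And>a e. (\<And>k. k \<in> K \<Longrightarrow> (\<Sum>e\<in>Y. a e * f e k) = 0) \<Longrightarrow> e \<in> Y \<Longrightarrow> a e = 0"
    and g_ind: "\<And>b s. (\<And>k. k \<in> K \<Longrightarrow> (\<Sum>s\<in>T. b s * g s k) = 0) \<Longrightarrow> s \<in> T \<Longrightarrow> b s = 0"
  shows "card Y + card T \<le> card K"
proof (rule ccontr)
  assume "\<not> ?thesis"
  then have "card K < card (Y <+> T)" using fin by (simp add: card_Plus)
  then obtain a where a: "\<exists>j\<in>Y <+> T. a j \<noteq> 0"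
    "\<And>k. k \<in> K \<Longrightarrow> (\<Sum>j\<in>Y <+> T. a j * (case j of Inl e \<Rightarrow> f e k | Inr s \<Rightarrow> g s k)) = 0"
    using underdetermined_system[OF fin(1), of "Y <+> T" "\<lambda>j k. case j of Inl e \<Rightarrow> f e k | Inr s \<Rightarrow> g s k"]
    by blast
  define y where "y k = (\<Sum>e\<in>Y. a (Inl e) * f e k)" for k
  define z where "z k = (\<Sum>s\<in>T. a (Inr s) * g s k)" for k
  have sum0: "y k + z k = 0" if "k \<in> K" for k
    using a(2)[OF that] fin by (simp add: sum.Plus y_def z_def)
  have "(\<Sum>k\<in>K. y k * z k) = (\<Sum>k\<in>K. \<Sum>e\<in>Y. \<Sum>s\<in>T. a (Inl e) * a (Inr s) * (f e k * g s k))"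
    by (simp add: y_def z_def sum_product mult_ac)
  also have "\<dots> = (\<Sum>e\<in>Y. \<Sum>s\<in>T. \<Sum>k\<in>K. a (Inl e) * a (Inr s) * (f e k * g s k))"
    by (subst sum.swap, rule sum.cong[OF refl], rule sum.swap)
  also have "\<dots> = 0" using orth by (simp flip: sum_distrib_left)
  finally have "(\<Sum>k\<in>K. z k * z k) = 0"
    using sum0 by (simp add: eq_neg_iff_add_eq_0[symmetric] sum_negf)
  then have z: "z k = 0" if "k \<in> K" for k
    using that fin(1) by (simp add: sum_nonneg_eq_0_iff)
  then have "a (Inr s) = 0" if "s \<in> T" for s
    using g_ind[of "\<lambda>s. a (Inr s)" s] that by (simp add: z_def)
  moreover have "a (Inl e) = 0" if "e \<in> Y" for e
    using f_ind[of "\<lambda>e. a (Inl e)" e] that z sum0 by (simp add: y_def)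
  ultimately show False using a(1) by auto
qed

lemma mat_kernel_trivial:
  fixes A :: "nat \<Rightarrow> nat \<Rightarrow> 'a::field"
  assumes det: "Determinant.det (Matrix.mat n n (\<lambda>(i, j). A i j)) \<noteq> 0"
    and ker: "\<And>i. i < n \<Longrightarrow> (\<Sum>j<n. A i j * x j) = 0" and "j < n"
  shows "x j = 0"
proof (rule ccontr)
  assume "x j \<noteq> 0"
  let ?A = "Matrix.mat n n (\<lambda>(i, j). A i j)" and ?x = "Matrix.vec n x"
  have "?x \<noteq> 0\<^sub>v n"
    using \<open>x j \<noteq> 0\<close> \<open>j < n\<close> by (metis index_vec index_zero_vec(1))
  moreover have "?A *\<^sub>v ?x = 0\<^sub>v n"
    using ker by (intro eq_vecI) (auto simp: scalar_prod_def lessThan_atLeast0)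
  ultimately show False
    using det det_0_iff_vec_prod_zero[of ?A n] by (metis mat_carrier vec_carrier)
qed

section \<open>Infinitesimal rotations\<close>

text \<open>For orthonormal \<open>a\<close> and \<open>b\<close>, the skew-symmetric generator of
  the rotations in their plane. It annihilates every vector orthogonal to both.\<close>

definition plane_rotation :: "'a::real_inner \<Rightarrow> 'a \<Rightarrow> 'a \<Rightarrow> 'a" where
  "plane_rotation a b y = inner b y *\<^sub>R a - inner a y *\<^sub>R b"

lemma plane_rotation_diff:
  "plane_rotation a b (x - y) = plane_rotation a b x - plane_rotation a b y"
  by (simp add: plane_rotation_def inner_diff_right algebra_simps)

text \<open>
  A skew-symmetric matrix \<open>C\<close> of size \<open>n\<close> vanishes if it annihilates \<open>n - 1\<close> independent vectors.
  These span a complement of the first coordinate axis, so the first row of \<open>C\<close> vanishes because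
  its first entry does, then the first column by symmetry, and then each row as the first one.
\<close>

lemma plane_rotations_independent:
  fixes e D :: "nat \<Rightarrow> 'a::real_inner"
  assumes ortho: "\<And>i j. i < n \<Longrightarrow> j < n \<Longrightarrow> inner (e i) (e j) = of_bool (i = j)"
    and det: "Determinant.det (Matrix.mat (n - 1) (n - 1) (\<lambda>(i, j). inner (e (Suc j)) (D i))) \<noteq> 0"
    and zero: "\<And>k. k < n - 1 \<Longrightarrow>
      (\<Sum>(j, i)\<in>(SIGMA j:{..<n}. {..<j}). \<beta> (j, i) *\<^sub>R plane_rotation (e j) (e i) (D k)) = 0"
    and ji: "j < n" "i < j"
  shows "\<beta> (j, i) = 0"
proof -
  obtain n' where n: "n = Suc n'" using ji by (cases n) auto
  \<comment> \<open>The matrix, with respect to the vectors \<open>e\<close>, of the given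
    combination of rotations; the \<open>\<beta> (j, i)\<close> fill its lower triangle.\<close>
  define C where "C l j = (if j < l then \<beta> (l, j) else if l < j then - \<beta> (j, l) else 0)" for l j
  have C_ann: "(\<Sum>j<n. C l j * inner (e j) (D k)) = 0" if l: "l < n" and k: "k < n'" for l k
  proof -
    let ?y = "D k"
    have "0 = inner (e l) (\<Sum>(j, i)\<in>(SIGMA j:{..<n}. {..<j}). \<beta> (j, i) *\<^sub>R plane_rotation (e j) (e i) ?y)"
      using zero[of k] k n by simp
    also have "\<dots> = (\<Sum>j<n. \<Sum>i<j. \<beta> (j, i) *
        (inner (e i) ?y * inner (e l) (e j) - inner (e j) ?y * inner (e l) (e i)))"
      by (simp add: sum.Sigma inner_sum_right plane_rotation_def inner_diff_right split_def)
    also have "\<dots> = (\<Sum>j<n. \<Sum>i<j. \<beta> (j, i) *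
        (inner (e i) ?y * of_bool (l = j) - inner (e j) ?y * of_bool (l = i)))"
      using l by (intro sum.cong) (auto simp: ortho)
    also have "\<dots> = (\<Sum>j<n. \<Sum>i<n. if i < j then \<beta> (j, i) *
        (inner (e i) ?y * of_bool (l = j) - inner (e j) ?y * of_bool (l = i)) else 0)"
      by (intro sum.cong[OF refl] sum.mono_neutral_cong_left) auto
    also have "\<dots> = (\<Sum>j<n. \<Sum>i<n. if l = j then (if i < j then \<beta> (j, i) * inner (e i) ?y else 0) else 0)
        - (\<Sum>j<n. \<Sum>i<n. if l = i then (if i < j then \<beta> (j, i) * inner (e j) ?y else 0) else 0)"
      unfolding sum_subtractf[symmetric] by (intro sum.cong refl) (auto simp: algebra_simps)
    also have "(\<Sum>j<n. \<Sum>i<n. if l = j then (if i < j then \<beta> (j, i) * inner (e i) ?y else 0) else 0)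
        = (\<Sum>i<n. if i < l then \<beta> (l, i) * inner (e i) ?y else 0)"
      using l by (subst sum.swap) (simp add: sum.delta)
    also have "(\<Sum>j<n. \<Sum>i<n. if l = i then (if i < j then \<beta> (j, i) * inner (e j) ?y else 0) else 0)
        = (\<Sum>j<n. if l < j then \<beta> (j, l) * inner (e j) ?y else 0)"
      using l by (simp add: sum.delta)
    also have "(\<Sum>i<n. if i < l then \<beta> (l, i) * inner (e i) ?y else 0)
        - (\<Sum>j<n. if l < j then \<beta> (j, l) * inner (e j) ?y else 0) = (\<Sum>j<n. C l j * inner (e j) ?y)"
      unfolding sum_subtractf[symmetric] by (intro sum.cong refl) (auto simp: C_def)
    finally show ?thesis by simp
  qed
  have row: "C l (Suc j) = 0" if "l < n" "C l 0 = 0" "j < n'" for l j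
  proof (rule mat_kernel_trivial[where x = "\<lambda>j. C l (Suc j)"])
    show "Determinant.det (Matrix.mat n' n' (\<lambda>(i, j). inner (e (Suc j)) (D i))) \<noteq> 0"
      using det n by simp
    show "(\<Sum>j<n'. inner (e (Suc j)) (D k) * C l (Suc j)) = 0" if "k < n'" for k
      using C_ann[OF \<open>l < n\<close> that] \<open>C l 0 = 0\<close>
      unfolding n sum.lessThan_Suc_shift by (simp add: mult.commute)
  qed fact
  have "C 0 0 = 0" by (simp add: C_def)
  then have row_0: "C 0 l = 0" if "l < n" for l
    using row[of 0 "l - 1"] that n by (cases l) auto
  have "C l 0 = 0" if "l < n" for l
    using row_0[OF that] by (auto simp: C_def split: if_splits)
  then have "C j i = 0" using row[of j "i - 1"] ji n by (cases i) auto
  then show ?thesis using ji by (simp add: C_def)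
qed

text \<open>The last sum counts the pairs of indices below \<open>d - k\<close>, which is how the
  rotations are indexed. Raising \<open>k\<close> by one takes \<open>d - Suc k\<close> off both
  sides.\<close>

lemma count_identity:
  fixes d :: nat
  assumes "k \<le> d"
  shows "int ((d + 1) choose 2) - (\<Sum>i = 1..k. int d - int i) = int d + int (\<Sum>j<d - k. j)"
  using assms
proof (induction k)
  case 0
  have "(d + 1) choose 2 = d + (\<Sum>j<d. j)"
    by (induction d) (simp_all add: numeral_2_eq_2)
  then show ?case by simp
next
  case (Suc k)
  then have "d - k = Suc (d - Suc k)" by simp
  then have "(\<Sum>j<d - k. j) = (\<Sum>j<d - Suc k. j) + (d - Suc k)" by simp
  then show ?case using Suc by (simp add: of_nat_diff)
qed

text \<open>The basis is enumerated by numbers, so that pairs with \<open>i < j\<close> can index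
  the rotations and \<open>Suc\<close> can skip the first axis.\<close>

lemma exists_orthonormal_complement:
  fixes W :: "'a::euclidean_space set"
  obtains e :: "nat \<Rightarrow> 'a" where
    "\<And>i j. i < DIM('a) - dim W \<Longrightarrow> j < DIM('a) - dim W \<Longrightarrow> inner (e i) (e j) = of_bool (i = j)"
    "\<And>i w. i < DIM('a) - dim W \<Longrightarrow> w \<in> W \<Longrightarrow> inner (e i) w = 0"
proof -
  let ?n = "DIM('a) - dim W" and ?S = "{y \<in> UNIV. \<forall>x\<in>span W. Linear_Algebra.orthogonal x y}"
  have "dim ?S + dim (span W) = dim (UNIV :: 'a set)"
    by (intro dim_subspace_orthogonal_to_vectors) auto
  then have dim: "dim ?S = ?n" by simp
  have "subspace ?S" using subspace_orthogonal_to_vectors[of "span W"] by simp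
  then obtain B where B: "B \<subseteq> ?S" "pairwise Linear_Algebra.orthogonal B" "\<And>x. x \<in> B \<Longrightarrow> norm x = 1"
    "independent B" "card B = dim ?S" "span B = ?S"
    by (rule orthonormal_basis_subspace) blast
  have "finite B" using B(4) by (rule independent_imp_finite)
  then obtain e where e: "bij_betw e {..<?n} B"
    using ex_bij_betw_nat_finite[of B] B(5) dim by (auto simp: lessThan_atLeast0)
  show thesis
  proof
    fix i assume i: "i < ?n"
    then have ei: "e i \<in> B" using bij_betwE[OF e] by simp
    show "inner (e i) w = 0" if "w \<in> W" for w
      using B(1) ei that by (auto simp: Linear_Algebra.orthogonal_def inner_commute span_base)
    show "inner (e i) (e j) = of_bool (i = j)" if j: "j < ?n" for j
    proof (cases "i = j")
      case True
      then show ?thesis using B(3)[OF ei] by (simp add: dot_square_norm)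
    next
      case False
      then have "e i \<noteq> e j" using i j bij_betw_imp_inj_on[OF e] by (auto dest: inj_onD)
      moreover have "e j \<in> B" using j bij_betwE[OF e] by simp
      ultimately show ?thesis using B(2) ei False by (auto simp: pairwise_def Linear_Algebra.orthogonal_def)
    qed
  qed
qed

text \<open>By skew symmetry the image of \<open>x\<close> is orthogonal to \<open>x\<close>; lying
  in the span of \<open>a\<close> and \<open>b\<close>, it is orthogonal to
  \<open>z\<close>.\<close>

lemma plane_rotation_orthogonal:
  assumes "inner a z = 0" and "inner b z = 0"
  shows "inner (plane_rotation a b x) (x - z) = 0"
  using assms by (simp add: plane_rotation_def inner_diff_left inner_diff_right)

text \<open>
  The translations and the rotations that fix the gain space are motions of the subframework of
  \<open>Y\<close>, once every vertex is moved by its potential \<open>q\<close>, so that the gains lie in the gain space.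
\<close>

lemma independent_rows_card_le:
  fixes G :: "('v, 'e) pre_digraph" and m :: "'e \<Rightarrow> int ^ 'd" and p :: "'v \<Rightarrow> real ^ 'd"
  assumes fin: "finite Y" and ne: "v 0 \<in> incident_verts G Y"
    and v: "\<And>i. i < n \<Longrightarrow> v i \<in> incident_verts G Y"
    and ortho: "\<And>i j. i < n \<Longrightarrow> j < n \<Longrightarrow> inner (e i) (e j) = of_bool (i = j)"
    and gain: "\<And>y i. y \<in> Y \<Longrightarrow> i < n \<Longrightarrow>
      inner (e i) (real_gain (m y - q (tail G y) + q (head G y))) = 0"
    and det: "Determinant.det (Matrix.mat (n - 1) (n - 1) (\<lambda>(i, j). inner (e (Suc j))
      (p (v (Suc i)) - real_gain (q (v (Suc i))) - (p (v 0) - real_gain (q (v 0)))))) \<noteq> 0"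
    and ind: "\<And>a y. (\<And>k. k \<in> incident_verts G Y \<times> UNIV \<Longrightarrow>
      (\<Sum>y\<in>Y. a y * rigidity_entry p (tail G y, head G y, m y) k) = 0) \<Longrightarrow> y \<in> Y \<Longrightarrow> a y = 0"
  shows "card Y + CARD('d) + (\<Sum>j<n. j) \<le> CARD('d) * card (incident_verts G Y)"
proof -
  let ?V = "incident_verts G Y" and ?P = "SIGMA j:{..<n}. {..<j}"
  let ?K = "?V \<times> (UNIV :: 'd set)"
  define s where "s x = p x - real_gain (q x)" for x
  define U :: "'d + nat \<times> nat \<Rightarrow> 'v \<Rightarrow> real ^ 'd" where
    "U t x = (case t of Inl c \<Rightarrow> axis c 1 | Inr (j, i) \<Rightarrow> plane_rotation (e j) (e i) (s x))" for t x
  define r where "r y = rigidity_entry p (tail G y, head G y, m y)" for y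
  have finV: "finite ?V" using fin by (simp add: incident_verts_def)
  have inc: "tail G y \<in> ?V" "head G y \<in> ?V" if "y \<in> Y" for y
    using that by (auto simp: incident_verts_def)
  have "card Y + card ((UNIV :: 'd set) <+> ?P) \<le> card ?K"
  proof (rule card_orthogonal_families[where f = r and g = "\<lambda>t k. U t (fst k) $ snd k"])
    show "finite ?K" "finite Y" "finite ((UNIV :: 'd set) <+> ?P)" using fin finV by auto
  next
    fix y t assume y: "y \<in> Y" and t: "t \<in> (UNIV :: 'd set) <+> ?P"
    let ?D = "s (tail G y) - s (head G y)"
    let ?z = "real_gain (m y - q (tail G y) + q (head G y))"
    have diff: "p (tail G y) - p (head G y) - real_gain (m y) = ?D - ?z"
      by (simp add: s_def real_gain_simps)
    have "inner (U t (tail G y) - U t (head G y)) (?D - ?z) = 0"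
    proof (cases t)
      case (Inl c)
      then show ?thesis by (simp add: U_def)
    next
      case (Inr ji)
      then obtain j i where ji: "t = Inr (j, i)" "j < n" "i < j" using t by auto
      then have "U t (tail G y) - U t (head G y) = plane_rotation (e j) (e i) ?D"
        by (simp add: U_def plane_rotation_diff)
      then show ?thesis
        using plane_rotation_orthogonal[OF gain[OF y, of j] gain[OF y, of i]] ji by simp
    qed
    then show "(\<Sum>k\<in>?K. r y k * U t (fst k) $ snd k) = 0"
      unfolding r_def using sum_rigidity_entry[OF finV inc[OF y], of p "m y" "U t"] diff by simp
  next
    show "a y = 0" if "\<And>k. k \<in> ?K \<Longrightarrow> (\<Sum>y\<in>Y. a y * r y k) = 0" "y \<in> Y" for a y
      using ind[of a y] that by (simp add: r_def)
  next
    fix b :: "'d + nat \<times> nat \<Rightarrow> real" and t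
    assume b: "\<And>k. k \<in> ?K \<Longrightarrow> (\<Sum>t\<in>(UNIV :: 'd set) <+> ?P. b t * U t (fst k) $ snd k) = 0"
      and t: "t \<in> (UNIV :: 'd set) <+> ?P"
    \<comment> \<open>A relation among the motions consists of a translation part \<open>T\<close>
      and a linear rotation part \<open>L\<close>. Differences with the base point
      \<open>v 0\<close> eliminate \<open>T\<close>, which isolates the rotations.\<close>
    define T where "T = (\<Sum>c\<in>UNIV. b (Inl c) *\<^sub>R axis c (1 :: real))"
    define L where "L y = (\<Sum>(j, i)\<in>?P. b (Inr (j, i)) *\<^sub>R plane_rotation (e j) (e i) y)" for y
    have TL: "T + L (s x) = 0" if "x \<in> ?V" for x
    proof -
      have "(T + L (s x)) $ c = (\<Sum>t\<in>(UNIV :: 'd set) <+> ?P. b t * U t x $ c)" for c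
        by (simp add: sum.Plus T_def L_def U_def sum_component split_def)
      then show ?thesis using b[of "(x, c)" for c] that by (simp add: Finite_Cartesian_Product.vec_eq_iff)
    qed
    have L_diff: "L (x - y) = L x - L y" for x y
      by (simp add: L_def plane_rotation_diff split_def scaleR_diff_right sum_subtractf)
    have rot: "b (Inr (j, i)) = 0" if "j < n" "i < j" for j i
    proof (rule plane_rotations_independent[where \<beta> = "\<lambda>ji. b (Inr ji)", OF ortho _ _ that])
      show "Determinant.det (Matrix.mat (n - 1) (n - 1)
          (\<lambda>(i, j). inner (e (Suc j)) (s (v (Suc i)) - s (v 0)))) \<noteq> 0"
        using det by (simp add: s_def)
      show "(\<Sum>(j, i)\<in>?P. b (Inr (j, i)) *\<^sub>R plane_rotation (e j) (e i) (s (v (Suc k)) - s (v 0))) = 0"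
        if "k < n - 1" for k
      proof -
        have "v (Suc k) \<in> ?V" using v[of "Suc k"] that by simp
        then have "T + L (s (v (Suc k))) = T + L (s (v 0))" using TL[OF ne] TL by simp
        then have "L (s (v (Suc k)) - s (v 0)) = 0" unfolding L_diff by simp
        then show ?thesis by (simp only: L_def)
      qed
    qed
    then have "L y = 0" for y unfolding L_def by (intro sum.neutral) auto
    then have "T = 0" using TL[OF ne] by simp
    moreover have "T $ c = b (Inl c)" for c
      by (simp add: T_def sum_component axis_def if_distrib sum.delta cong: if_cong)
    ultimately have "b (Inl c) = 0" for c by (metis zero_index)
    then show "b t = 0" using rot t by auto
  qed
  moreover have "card ((UNIV :: 'd set) <+> ?P) = CARD('d) + (\<Sum>j<n. j)"
    by (subst card_Plus) auto
  ultimately show ?thesis by (simp add: card_cartesian_product mult.commute)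
qed

section \<open>The edge count for subgraphs\<close>

theorem theorem5p2:
  fixes G :: "('v, 'e) pre_digraph" and m :: "'e \<Rightarrow> int ^ 'd"
  assumes "orbit_graph G m"
    and "generically_minimally_rigid G m"
  shows "\<forall>Y \<subseteq> arcs G.
    CARD('d) \<le> card (incident_verts G Y) + int_rank (gain_space G m Y) \<longrightarrow>
    int (card Y) \<le> int CARD('d) * int (card (incident_verts G Y)) - int ((CARD('d) + 1) choose 2)
      + (\<Sum>i = 1..int_rank (gain_space G m Y). int CARD('d) - int i)"
proof (intro allI impI)
  fix Y assume Y: "Y \<subseteq> arcs G"
    and le: "CARD('d) \<le> card (incident_verts G Y) + int_rank (gain_space G m Y)"
  interpret fin_digraph G using assms(1) by (simp add: orbit_graph_def)
  let ?V = "incident_verts G Y" and ?M = "gain_space G m Y"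
  \<comment> \<open>The dimension of the orthogonal complement of the gain space, in which the
    rotations act.\<close>
  define n where "n = CARD('d) - int_rank ?M"
  have finY: "finite Y" using Y finite_arcs by (rule finite_subset)
  have finV: "finite ?V" using finY by (simp add: incident_verts_def)
  have VG: "?V \<subseteq> verts G" using Y by (auto simp: incident_verts_def)
  have rank: "int_rank ?M = dim (real_gain ` ?M)" by (rule int_rank_eq_dim)
  then have rank_le: "int_rank ?M \<le> CARD('d)"
    using dim_subset_UNIV[of "real_gain ` ?M"] by simp
  \<comment> \<open>For empty \<open>Y\<close> both summands on the right of \<open>le\<close> are
    0, but the dimension is positive.\<close>
  have "Y \<noteq> {}"
  proof
    assume "Y = {}"
    then have "{net_gain m c | c. undirected_cycle G c \<and> fst ` set c \<subseteq> Y} = {}"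
      by (auto simp: undirected_cycle_def pre_digraph.cycle_def)
    then have "?M = int_vec.span {}" by (simp only: gain_space_def)
    then have "real_gain ` ?M = {0}" by (simp add: real_gain_simps)
    then have "int_rank ?M = 0" using rank by simp
    then show False using le \<open>Y = {}\<close> by (simp add: incident_verts_def)
  qed
  then have "?V \<noteq> {}" by (auto simp: incident_verts_def)
  then have "card ?V \<ge> 1" using finV by (simp add: Suc_leI card_gt_0_iff)
  \<comment> \<open>The base point \<open>v 0\<close> must exist even if \<open>n = 0\<close>, hence
    the maximum with 1.\<close>
  then have card_V: "max 1 n \<le> card ?V" using le by (simp add: n_def)
  obtain v where h: "bij_betw v {0..<card ?V} ?V" using ex_bij_betw_nat_finite[OF finV] by blast
  have v: "v i \<in> ?V" if "i < max 1 n" for i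
    using bij_betwE[OF h] less_le_trans[OF that card_V] by simp
  have v_inj: "v i = v j \<longleftrightarrow> i = j" if "i < max 1 n" "j < max 1 n" for i j
    using bij_betw_imp_inj_on[OF h] that[THEN less_le_trans, OF card_V]
    by (simp add: inj_on_eq_iff)
  obtain q where q: "\<And>y. y \<in> Y \<Longrightarrow> m y - q (tail G y) + q (head G y) \<in> ?M"
    using exists_potential[OF wf_digraph_axioms finY Y, of m] by blast
  obtain e :: "nat \<Rightarrow> real ^ 'd" where
    ortho: "\<And>i j. i < n \<Longrightarrow> j < n \<Longrightarrow> inner (e i) (e j) = of_bool (i = j)" and
    perp: "\<And>i w. i < n \<Longrightarrow> w \<in> real_gain ` ?M \<Longrightarrow> inner (e i) w = 0"
    using exists_orthonormal_complement[of "real_gain ` ?M"] by (auto simp: n_def rank)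
  \<comment> \<open>The coordinates along \<open>e 1, ..., e (n - 1)\<close> of the differences
    between the moved points and the moved base point. Only \<open>n - 1\<close> independent
    differences are asked for, which takes \<open>n\<close> vertices.\<close>
  define f where "f p = Determinant.det (Matrix.mat (n - 1) (n - 1) (\<lambda>(i, j). inner (e (Suc j))
    (p (v (Suc i)) - real_gain (q (v (Suc i))) - (p (v 0) - real_gain (q (v 0))))))"
    for p :: "'v \<Rightarrow> real ^ 'd"
  \<comment> \<open>A configuration with \<open>f r \<noteq> 0\<close>: after the move by the
    potential, \<open>v 0\<close> lies at the origin and \<open>v (Suc i)\<close> at
    \<open>e (Suc i)\<close>, so the matrix is the identity.\<close>
  define r where "r x = real_gain (q x) + (\<Sum>i<n - 1. if x = v (Suc i) then e (Suc i) else 0)" for x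
  have r_v: "r (v (Suc i)) = real_gain (q (v (Suc i))) + e (Suc i)" if "i < n - 1" for i
  proof -
    have "(\<Sum>k<n - 1. if v (Suc i) = v (Suc k) then e (Suc k) else 0) =
        (\<Sum>k<n - 1. if i = k then e (Suc k) else 0)"
      using that by (intro sum.cong refl if_cong) (auto simp: v_inj)
    then show ?thesis using that by (simp add: r_def sum.delta')
  qed
  have r_0: "r (v 0) = real_gain (q (v 0))"
    unfolding r_def by (auto intro!: sum.neutral simp: v_inj)
  have unit: "Matrix.mat (n - 1) (n - 1) (\<lambda>(i, j). inner (e (Suc j))
      (r (v (Suc i)) - real_gain (q (v (Suc i))) - (r (v 0) - real_gain (q (v 0))))) = 1\<^sub>m (n - 1)"
    by (rule eq_matI) (auto simp: r_v r_0 ortho)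
  have f_r: "f r \<noteq> 0" unfolding f_def unit by simp
  have f_poly: "coordinatewise_polynomial (\<lambda>x. f (\<lambda>v. \<chi> c. x (v, c)))"
    unfolding coordinatewise_polynomial_def f_def
    by (intro allI real_polynomial_function_det)
      (simp add: inner_vec_def del: fun_upd_apply,
        intro real_polynomial_function_sum real_polynomial_function.intros(2,4)
          real_polynomial_function_diff real_polynomial_function_fun_upd finite)
  have f_dep: "f p = f p'" if "\<And>x. x \<in> verts G \<Longrightarrow> p x = p' x" for p p'
    unfolding f_def using that v VG
    by (intro arg_cong[where f = Determinant.det] cong_mat refl) (simp add: subset_iff)
  obtain p where p: "inj_on p (verts G)"
    "\<forall>x\<in>verts G. \<forall>c. 0 \<le> p x $ c \<and> p x $ c < 1" "generic (verts G) p" "f p \<noteq> 0"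
    by (rule generic_torus_framework_nonroot[OF finite_verts f_poly f_dep f_r]) blast
  have rigid: "infinitesimally_rigid G m p"
    using assms(2) p by (simp add: generically_minimally_rigid_def torus_framework_def)
  have card_G: "int (card (arcs G)) = int CARD('d) * int (card (verts G)) - int CARD('d)"
    using assms(2) by (simp add: generically_minimally_rigid_def)
  have "card Y + CARD('d) + (\<Sum>j<n. j) \<le> CARD('d) * card ?V"
  proof (rule independent_rows_card_le[where v = v and e = e and q = q and m = m and p = p])
    show "finite Y" by (rule finY)
    show "v 0 \<in> ?V" by (rule v) simp
    show "v i \<in> ?V" if "i < n" for i using that by (intro v) simp
    show "inner (e i) (e j) = of_bool (i = j)" if "i < n" "j < n" for i j
      by (rule ortho[OF that])
    show "inner (e i) (real_gain (m y - q (tail G y) + q (head G y))) = 0"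
      if "y \<in> Y" "i < n" for y i
      by (rule perp[OF that(2) imageI[OF q[OF that(1)]]])
    show "Determinant.det (Matrix.mat (n - 1) (n - 1) (\<lambda>(i, j). inner (e (Suc j))
        (p (v (Suc i)) - real_gain (q (v (Suc i))) - (p (v 0) - real_gain (q (v 0)))))) \<noteq> 0"
      using p(4) unfolding f_def .
  next
    fix a y
    assume a: "\<And>k. k \<in> ?V \<times> UNIV \<Longrightarrow>
        (\<Sum>y\<in>Y. a y * rigidity_entry p (tail G y, head G y, m y) k) = 0" and y: "y \<in> Y"
    \<comment> \<open>A relation among the rows of \<open>Y\<close>, extended by zero to all arcs.
      It holds in every column, since the rows of \<open>Y\<close> vanish outside the columns of
      \<open>V(Y)\<close>.\<close>
    define a' where "a' y = (if y \<in> Y then a y else 0)" for y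
    have rel: "(\<Sum>y\<in>arcs G. a' y * rigidity_entry p (tail G y, head G y, m y) k) = 0" for k
    proof -
      have "(\<Sum>y\<in>arcs G. a' y * rigidity_entry p (tail G y, head G y, m y) k) =
          (\<Sum>y\<in>Y. a y * rigidity_entry p (tail G y, head G y, m y) k)"
        using Y by (intro sum.mono_neutral_cong_right) (auto simp: a'_def)
      also have "\<dots> = 0"
      proof (cases "fst k \<in> ?V")
        case True
        then show ?thesis using a[of k] by (cases k) simp
      next
        case False
        then have "rigidity_entry p (tail G y, head G y, m y) k = 0" if "y \<in> Y" for y
          using that by (cases k) (auto simp: rigidity_entry_def incident_verts_def)
        then show ?thesis by simp
      qed
      finally show ?thesis .
    qed
    have "v 0 \<in> verts G" using v[of 0] VG by (simp add: subset_iff)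
    then have "a' y = 0"
      by (rule rigid_imp_independent[OF fin_digraph_axioms card_G _ rigid rel subsetD[OF Y y]])
    then show "a y = 0" using y by (simp add: a'_def)
  qed
  then have "int (card Y + CARD('d) + (\<Sum>j<n. j)) \<le> int (CARD('d) * card ?V)"
    by (simp only: of_nat_le_iff)
  then have "int (card Y) + int CARD('d) + int (\<Sum>j<n. j) \<le> int CARD('d) * int (card ?V)"
    by (simp only: of_nat_add of_nat_mult)
  then show "int (card Y) \<le> int CARD('d) * int (card ?V) - int ((CARD('d) + 1) choose 2)
      + (\<Sum>i = 1..int_rank ?M. int CARD('d) - int i)"
    using count_identity[OF rank_le] unfolding n_def by linarith
qed

end
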